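(* Let $m,k\in\mathbb Z^+$, $a_1,\ldots,a_k\in\mathbb Z$, $n_1,\ldots,n_k\in\mathbb Z^+$. For $n\in\mathbb N$ and real $0\leqslant\alpha<1$ define $$S(n,\alpha)=\sum_{\substack{m_1,\ldots,m_k\in\mathbb Z^+\\ \{\sum_{s=1}^km_s/n_s\}=\alpha}}(-1)^{\lfloor\sum_{s=1}^km_s/n_s\rfloor}\binom{n}{\lfloor\sum_{s=1}^km_s/n_s\rfloor}e^{2\pi i\sum_{s=1}^ka_sm_s/n_s}$$ (a finite sum, since the binomial coefficient vanishes once $\lfloor\sum_s m_s/n_s\rfloor>n$). Then the system $\{a_s(n_s)\}_{s=1}^k$ is an $m$-system (i.e. every $x\in\mathbb Z$ satisfies $|\{1\leqslant s\leqslant k: x\equiv a_s\pmod{n_s}\}|\leqslant m$) if and only if for every integer $n$ with $m\leqslant n<k$ and every $0\leqslant\alpha<1$, $$S(n,\alpha)=\begin{cases}(-1)^k&\text{if }\alpha=0,\\ 0&\text{if }0<\alpha<1.\end{cases}$$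
   Context: $\{x\}$ and $\lfloor x\rfloor$ denote the fractional and integer parts of a real $x$; $\binom{n}{j}=0$ for integers $j>n\geqslant0$. *)

theory Defs
  imports "HOL-Analysis.Analysis" "HOL-Number_Theory.Cong"
begin

definition m_system :: "nat \<Rightarrow> nat \<Rightarrow> (nat \<Rightarrow> int) \<Rightarrow> (nat \<Rightarrow> nat) \<Rightarrow> bool" where
  "m_system m k a N \<longleftrightarrow> (\<forall>x::int. card {s \<in> {1..k}. [x = a s] (mod int (N s))} \<le> m)"

definition frac_sum :: "nat \<Rightarrow> (nat \<Rightarrow> nat) \<Rightarrow> (nat \<Rightarrow> nat) \<Rightarrow> real" where
  "frac_sum k N f = (\<Sum>s=1..k. real (f s) / real (N s))"

text \<open>
  The tuples \<open>(m\<^sub>1, \<dots>, m\<^sub>k)\<close> of positive integers are the functions in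
  \<open>{1..k} \<rightarrow>\<^sub>E {1..}\<close>. There are infinitely many of them, so the sum is written with
  \<^const>\<open>infsum\<close>; only finitely many summands are nonzero, and \<open>S_sum_eq_finite_sum\<close> below
  shows that it is the ordinary finite sum. The floor is nonnegative, so \<^const>\<open>nat\<close>
  does not truncate.
\<close>
definition S_sum :: "nat \<Rightarrow> (nat \<Rightarrow> int) \<Rightarrow> (nat \<Rightarrow> nat) \<Rightarrow> nat \<Rightarrow> real \<Rightarrow> complex" where
  "S_sum k a N n \<alpha> =
     (\<Sum>\<^sub>\<infinity>f \<in> {f \<in> {1..k} \<rightarrow>\<^sub>E {1..}. frac (frac_sum k N f) = \<alpha>}.
        (-1) ^ nat \<lfloor>frac_sum k N f\<rfloor> * of_nat (n choose nat \<lfloor>frac_sum k N f\<rfloor>) *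
        exp (2 * of_real pi * \<i> *
          (\<Sum>s=1..k. of_int (a s) * of_nat (f s) / of_nat (N s))))"

lemma frac_sum_nonneg: "frac_sum k N f \<ge> 0"
  unfolding frac_sum_def by (intro sum_nonneg) auto

lemma finite_bounded_tuples:
  assumes "\<And>s. s \<in> {1..k} \<Longrightarrow> N s > 0"
  shows "finite {f \<in> {1..k} \<rightarrow>\<^sub>E {1..}. frac (frac_sum k N f) = \<alpha> \<and> \<lfloor>frac_sum k N f\<rfloor> \<le> int n}"
proof (rule finite_subset)
  show "finite (\<Pi>\<^sub>E s\<in>{1..k}. {..(n + 1) * N s})"
    by (intro finite_PiE) auto
  show "{f \<in> {1..k} \<rightarrow>\<^sub>E {1..}. frac (frac_sum k N f) = \<alpha> \<and> \<lfloor>frac_sum k N f\<rfloor> \<le> int n}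
    \<subseteq> (\<Pi>\<^sub>E s\<in>{1..k}. {..(n + 1) * N s})"
  proof
    fix f
    assume "f \<in> {f \<in> {1..k} \<rightarrow>\<^sub>E {1..}. frac (frac_sum k N f) = \<alpha> \<and> \<lfloor>frac_sum k N f\<rfloor> \<le> int n}"
    then have f: "f \<in> {1..k} \<rightarrow>\<^sub>E {1..}" and fl: "\<lfloor>frac_sum k N f\<rfloor> \<le> int n"
      by auto
    have le: "frac_sum k N f \<le> real (n + 1)"
      using fl by linarith
    have "f s \<le> (n + 1) * N s" if s: "s \<in> {1..k}" for s
    proof -
      have "real (f s) / real (N s) \<le> frac_sum k N f"
        unfolding frac_sum_def
        by (rule member_le_sum[where f = "\<lambda>s. real (f s) / real (N s)"]) (use s in auto)
      then have "real (f s) / real (N s) \<le> real (n + 1)"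
        using le by linarith
      then have "real (f s) \<le> real (n + 1) * real (N s)"
        using assms[OF s] by (simp add: divide_le_eq)
      then have "real (f s) \<le> real ((n + 1) * N s)"
        by (simp only: of_nat_mult)
      then show ?thesis
        by (simp only: of_nat_le_iff)
    qed
    then show "f \<in> (\<Pi>\<^sub>E s\<in>{1..k}. {..(n + 1) * N s})"
      using f by (auto simp: PiE_iff)
  qed
qed

lemma S_sum_eq_finite_sum:
  assumes "\<And>s. s \<in> {1..k} \<Longrightarrow> N s > 0"
  shows "S_sum k a N n \<alpha> =
     (\<Sum>f \<in> {f \<in> {1..k} \<rightarrow>\<^sub>E {1..}. frac (frac_sum k N f) = \<alpha> \<and> \<lfloor>frac_sum k N f\<rfloor> \<le> int n}.
        (-1) ^ nat \<lfloor>frac_sum k N f\<rfloor> * of_nat (n choose nat \<lfloor>frac_sum k N f\<rfloor>) *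
        exp (2 * of_real pi * \<i> *
          (\<Sum>s=1..k. of_int (a s) * of_nat (f s) / of_nat (N s))))"
proof -
  have fin: "finite {f \<in> {1..k} \<rightarrow>\<^sub>E {1..}. frac (frac_sum k N f) = \<alpha> \<and> \<lfloor>frac_sum k N f\<rfloor> \<le> int n}"
    using assms by (rule finite_bounded_tuples)
  show ?thesis
    unfolding S_sum_def
    by (subst infsum_finite[OF fin, symmetric], rule infsum_cong_neutral) (auto simp: binomial_eq_0)
qed

end

theory Submission
  imports Defs "HOL-Computational_Algebra.Polynomial_FPS"
    "HOL-Computational_Algebra.Fundamental_Theorem_Algebra" "HOL-Library.Real_Mod"
begin

text \<open>
  Let \<open>D\<close> be the product of the moduli, \<open>d\<^sub>s = D / n\<^sub>s\<close>, \<open>w\<^sub>s = exp (2 \<pi> i a\<^sub>s / n\<^sub>s)\<close> and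
  \<open>P = \<Prod>\<^sub>s (1 - w\<^sub>s X\<^bsup>d\<^sub>s\<^esup>)\<close>. The order of \<open>P\<close> at \<open>exp (-2 \<pi> i x / D)\<close> is the number of \<open>s\<close> with
  \<open>x \<equiv> a\<^sub>s (mod n\<^sub>s)\<close>, and \<open>P\<close> has no other roots; hence the system is an \<open>m\<close>-system iff
  \<open>P\<close> divides \<open>(1 - X\<^sup>D)\<^sup>m\<close>. The rational function \<open>F = \<Prod>\<^sub>s w\<^sub>s X\<^bsup>d\<^sub>s\<^esup> / (1 - w\<^sub>s X\<^bsup>d\<^sub>s\<^esup>)\<close> has the value
  \<open>(-1)\<^sup>k\<close> at infinity, so \<open>P\<close> divides \<open>(1 - X\<^sup>D)\<^sup>n\<close> iff \<open>(1 - X\<^sup>D)\<^sup>n E\<close> is a polynomial of degree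
  less than \<open>n D\<close>, where \<open>E = F - (-1)\<^sup>k\<close>.
  For \<open>0 \<le> r < D\<close>, the coefficient of \<open>X\<^bsup>n D + r\<^esup>\<close> in \<open>(1 - X\<^sup>D)\<^sup>n E\<close> is, up to sign,
  the difference between \<open>S(n, r/D)\<close> and its claimed value. If these coefficients vanish for all
  \<open>n \<ge> m\<close>, then so do all coefficients of \<open>(1 - X\<^sup>D)\<^sup>m E\<close> from \<open>X\<^bsup>m D\<^esup>\<close> on. For \<open>n \<ge> k\<close> they
  vanish automatically, since every system is a \<open>k\<close>-system.
\<close>

unbundle no vec_syntax
unbundle fps_syntax

section \<open>Root multiplicities and divisibility of complex polynomials\<close>

lemma order_prod_poly:
  fixes p :: "'b \<Rightarrow> 'a::idom poly"
  assumes "finite A" "\<And>s. s \<in> A \<Longrightarrow> p s \<noteq> 0"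
  shows "order x (\<Prod>s\<in>A. p s) = (\<Sum>s\<in>A. order x (p s))"
  using assms by (induction A rule: finite_induct) (auto simp: order_mult)

text \<open>Over the complex numbers a polynomial is its leading coefficient times a product of
  linear factors, so divisibility amounts to comparing the exponents root by root.\<close>

lemma complex_poly_dvd_iff_order_le:
  fixes p q :: "complex poly"
  assumes "p \<noteq> 0" "q \<noteq> 0"
  shows "p dvd q \<longleftrightarrow> (\<forall>x. order x p \<le> order x q)"
proof
  assume "p dvd q"
  with assms show "\<forall>x. order x p \<le> order x q"
    by (simp add: dvd_imp_order_le)
next
  assume le: "\<forall>x. order x p \<le> order x q"
  have "(\<Prod>z|poly p z = 0. [:-z, 1:] ^ order z p) dvd (\<Prod>z|poly p z = 0. [:-z, 1:] ^ order z q)"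
    by (intro prod_dvd_prod le_imp_power_dvd) (use le in auto)
  also have "\<dots> dvd (\<Prod>z|poly q z = 0. [:-z, 1:] ^ order z q)"
  proof (rule prod_dvd_prod_subset)
    show "{z. poly p z = 0} \<subseteq> {z. poly q z = 0}"
    proof
      fix z assume "z \<in> {z. poly p z = 0}"
      then have "order z q \<noteq> 0"
        using le[rule_format, of z] assms(1) by (auto simp: order_root)
      then show "z \<in> {z. poly q z = 0}"
        by (auto simp: order_root)
    qed
  qed (use assms(2) poly_roots_finite in auto)
  \<comment> \<open>Nonzero leading coefficients are units and do not affect divisibility.\<close>
  finally have "smult (lead_coeff p) (\<Prod>z|poly p z = 0. [:-z, 1:] ^ order z p) dvd
      smult (lead_coeff q) (\<Prod>z|poly q z = 0. [:-z, 1:] ^ order z q)"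
    using assms by (simp add: smult_dvd_iff dvd_smult)
  then show "p dvd q"
    by (simp only: complex_poly_decompose)
qed

text \<open>All roots are simple: the derivative can vanish only at 0, where the polynomial has the
  value 1.\<close>

lemma order_one_minus_monom:
  fixes c :: complex
  assumes "c \<noteq> 0" "d > 0"
  shows "order x (1 - monom c d) = (if c * x ^ d = 1 then 1 else 0)"
proof -
  let ?p = "1 - monom c d"
  have "rsquarefree ?p"
    unfolding rsquarefree_roots
  proof (intro allI notI)
    fix y assume "poly ?p y = 0 \<and> poly (pderiv ?p) y = 0"
    then have "c * y ^ d = 1" "y ^ (d - 1) = 0"
      using assms by (auto simp: poly_monom pderiv_diff pderiv_monom)
    then show False
      using assms by (auto simp: power_0_left)
  qed
  then show ?thesis
    using order_root[of ?p x] by (force simp: rsquarefree_def poly_monom)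
qed

lemma degree_one_minus_monom:
  fixes c :: complex
  assumes "c \<noteq> 0" "d > 0"
  shows "degree (1 - monom c d) = d" "lead_coeff (1 - monom c d) = - c" "1 - monom c d \<noteq> 0"
proof -
  show deg: "degree (1 - monom c d) = d"
  proof (rule antisym)
    show "degree (1 - monom c d) \<le> d"
      by (intro degree_diff_le) (auto intro: degree_monom_le)
    show "d \<le> degree (1 - monom c d)"
      using assms by (intro le_degree) auto
  qed
  show "lead_coeff (1 - monom c d) = - c"
    unfolding deg using assms by simp
  then show "1 - monom c d \<noteq> 0"
    using assms by (metis leading_coeff_0_iff neg_equal_0_iff_equal)
qed

section \<open>Geometric power series and their products\<close>

text \<open>The expansion of \<open>c X^d / (1 - c X^d)\<close>. It has no constant term because the
  \<open>m_s\<close> range over positive integers.\<close>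

definition fps_geom :: "complex \<Rightarrow> nat \<Rightarrow> complex fps" where
  "fps_geom c d = Abs_fps (\<lambda>M. if 0 < M \<and> d dvd M then c ^ (M div d) else 0)"

lemma fps_geom_mult:
  assumes "d > 0"
  shows "fps_geom c d * fps_of_poly (1 - monom c d) = fps_of_poly (monom c d)"
proof (rule fps_ext)
  fix M
  have "fps_geom c d * fps_of_poly (1 - monom c d) =
      fps_geom c d - fps_const c * (fps_X ^ d * fps_geom c d)"
    by (simp add: fps_of_poly_diff fps_of_poly_monom algebra_simps)
  then have "(fps_geom c d * fps_of_poly (1 - monom c d)) $ M =
      fps_geom c d $ M - c * (if M < d then 0 else fps_geom c d $ (M - d))"
    by (simp add: fps_X_power_mult_nth)
  \<comment> \<open>Neighbouring powers of \<open>c\<close> cancel, except at \<open>M = d\<close>: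
    there the subtracted coefficient is the one at 0, which is 0.\<close>
  also have "\<dots> = (if M = d then c else 0)"
    using assms by (auto simp: fps_geom_def le_div_geq dvd_minus_self dest: dvd_imp_le)
  finally show "(fps_geom c d * fps_of_poly (1 - monom c d)) $ M = fps_of_poly (monom c d) $ M"
    by simp
qed

lemma fps_mult_nth_cong:
  assumes "\<And>i. i \<le> B \<Longrightarrow> f $ i = f' $ i" "\<And>i. i \<le> B \<Longrightarrow> g $ i = g' $ i" "M \<le> B"
  shows "(f * g) $ M = (f' * g') $ M"
  unfolding fps_mult_nth by (intro sum.cong) (use assms in auto)

text \<open>Allows series to be truncated before a coefficient of their product is computed.\<close>

lemma fps_prod_nth_cong:
  fixes f g :: "'b \<Rightarrow> 'a::comm_ring_1 fps"
  assumes "finite A" "\<And>s i. s \<in> A \<Longrightarrow> i \<le> B \<Longrightarrow> f s $ i = g s $ i" "M \<le> B"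
  shows "(\<Prod>s\<in>A. f s) $ M = (\<Prod>s\<in>A. g s) $ M"
  using assms
proof (induction A arbitrary: M rule: finite_induct)
  case (insert s A)
  then show ?case
    by (simp, intro fps_mult_nth_cong[where B = B]) auto
qed simp

lemma prod_monom:
  "finite A \<Longrightarrow> (\<Prod>s\<in>A. monom (c s) (d s)) = monom (\<Prod>s\<in>A. c s) (\<Sum>s\<in>A. d s)"
  for c :: "'b \<Rightarrow> 'a::comm_semiring_1"
  by (induction A rule: finite_induct) (auto simp: mult_monom one_pCons monom_0)

text \<open>Expanding the product means choosing an exponent \<open>d s * f s\<close> in each
  factor. To keep the expansion finite, each series is first cut down to the polynomial
  \<open>?T s\<close>.\<close>

lemma fps_prod_geom_nth:
  assumes "finite A" "\<And>s. s \<in> A \<Longrightarrow> d s > 0"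
  shows "(\<Prod>s\<in>A. fps_geom (c s) (d s)) $ M =
    (\<Sum>f | f \<in> A \<rightarrow>\<^sub>E {1..} \<and> (\<Sum>s\<in>A. d s * f s) = M. \<Prod>s\<in>A. c s ^ f s)"
proof -
  let ?T = "\<lambda>s. \<Sum>j\<in>{1..M}. fps_of_poly (monom (c s ^ j) (d s * j))"
  have "(\<Prod>s\<in>A. fps_geom (c s) (d s)) $ M = (\<Prod>s\<in>A. ?T s) $ M"
  proof (rule fps_prod_nth_cong[where B = M])
    fix s i assume s: "s \<in> A" and i: "i \<le> M"
    note d = assms(2)[OF s]
    have "?T s $ i = (\<Sum>j\<in>{1..M}. if i = d s * j then c s ^ j else 0)"
      by (auto simp: fps_sum_nth intro!: sum.cong)
    also have "\<dots> = fps_geom (c s) (d s) $ i"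
    proof (cases "0 < i \<and> d s dvd i")
      case True
      then obtain t where t: "i = d s * t" "t > 0" by (auto elim!: dvdE)
      have "t \<le> i" using t d by simp
      then have "t \<le> M" using i by (rule order_trans)
      then have "t \<in> {1..M}" using t by auto
      then show ?thesis
        using d t by (simp add: fps_geom_def)
    next
      case False
      then show ?thesis using d
        by (auto simp: fps_geom_def intro!: sum.neutral)
    qed
    finally show "fps_geom (c s) (d s) $ i = ?T s $ i" ..
  qed (use assms in auto)
  also have "(\<Prod>s\<in>A. ?T s) = (\<Sum>f\<in>A \<rightarrow>\<^sub>E {1..M}. \<Prod>s\<in>A. fps_of_poly (monom (c s ^ f s) (d s * f s)))"
    using assms(1) by (intro prod_sum_PiE) auto
  also have "\<dots> = (\<Sum>f\<in>A \<rightarrow>\<^sub>E {1..M}. fps_of_poly (monom (\<Prod>s\<in>A. c s ^ f s) (\<Sum>s\<in>A. d s * f s)))"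
    using assms(1) by (simp add: fps_of_poly_prod [symmetric] prod_monom)
  also have "\<dots> $ M = (\<Sum>f\<in>A \<rightarrow>\<^sub>E {1..M}. if (\<Sum>s\<in>A. d s * f s) = M then \<Prod>s\<in>A. c s ^ f s else 0)"
    by (simp add: fps_sum_nth)
  also have "\<dots> = (\<Sum>f | f \<in> A \<rightarrow>\<^sub>E {1..M} \<and> (\<Sum>s\<in>A. d s * f s) = M. \<Prod>s\<in>A. c s ^ f s)"
    using assms(1) by (intro sum.inter_filter [symmetric] finite_PiE) auto
  \<comment> \<open>The bound \<open>M\<close> introduced by the truncation is automatic, since
    \<open>f s \<le> d s * f s \<le> M\<close>.\<close>
  also have "{f. f \<in> A \<rightarrow>\<^sub>E {1..M} \<and> (\<Sum>s\<in>A. d s * f s) = M} =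
      {f. f \<in> A \<rightarrow>\<^sub>E {1..} \<and> (\<Sum>s\<in>A. d s * f s) = M}"
  proof -
    have "f s \<le> M" if "(\<Sum>s\<in>A. d s * f s) = M" "s \<in> A" for f s
    proof -
      have "f s \<le> d s * f s" using assms(2)[OF that(2)] by simp
      also have "\<dots> \<le> (\<Sum>s\<in>A. d s * f s)"
        using assms(1) that(2) by (intro member_le_sum) auto
      finally show ?thesis using that by simp
    qed
    then show ?thesis by (auto simp: PiE_iff)
  qed
  finally show ?thesis .
qed

section \<open>Coefficients after multiplication by powers of \<open>1 - X^D\<close>\<close>

lemma one_minus_X_power_mult_nth:
  fixes F :: "complex fps"
  shows "((1 - fps_X ^ D) ^ n * F) $ (n * D + r) =
    (-1) ^ n * (\<Sum>j\<le>n. (-1) ^ j * of_nat (n choose j) * F $ (j * D + r))"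
proof -
  have "(1 - fps_X ^ D) ^ n = (\<Sum>j\<le>n. of_nat (n choose j) * (- (fps_X ^ D)) ^ j * 1 ^ (n - j) :: complex fps)"
    using binomial_ring[of "- (fps_X ^ D)" "1 :: complex fps" n] by simp
  also have "\<dots> = (\<Sum>j\<le>n. fps_const ((-1) ^ j * of_nat (n choose j)) * fps_X ^ (D * j))"
    by (intro sum.cong refl)
      (auto simp: power_minus[of "fps_X ^ D"] power_mult fps_of_nat [symmetric] fps_const_neg
        fps_const_power [symmetric] fps_const_mult [symmetric]
        simp del: fps_const_power fps_const_mult fps_const_neg)
  finally have "((1 - fps_X ^ D) ^ n * F) $ (n * D + r) =
      (\<Sum>j\<le>n. (-1) ^ j * of_nat (n choose j) * F $ (n * D + r - D * j))"
    by (simp add: sum_distrib_right fps_sum_nth mult.assoc fps_X_power_mult_nth)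
      (intro sum.cong refl, auto simp: not_less mult.commute[of n] dest: add_lessD1)
  \<comment> \<open>Reversing the summation makes \<open>j\<close> the number of the block of length
    \<open>D\<close> that is read off, which is the floor in the definition of
    \<open>S_sum\<close>.\<close>
  also have "\<dots> = (\<Sum>j\<le>n. (-1) ^ (n - j) * of_nat (n choose (n - j)) * F $ (n * D + r - D * (n - j)))"
    by (rule sum.reindex_bij_witness[of _ "\<lambda>j. n - j" "\<lambda>j. n - j"]) auto
  also have "\<dots> = (\<Sum>j\<le>n. (-1) ^ n * ((-1) ^ j * of_nat (n choose j) * F $ (j * D + r)))"
  proof (intro sum.cong refl)
    fix j assume "j \<in> {..n}"
    then obtain i where i: "n = j + i" by (auto simp: le_iff_add)
    have "n * D + r - D * (n - j) = j * D + r"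
      by (simp add: i algebra_simps)
    moreover have "(-1) ^ (n - j) = (-1) ^ n * (-1 :: complex) ^ j"
      by (simp add: i power_add)
    moreover have "n choose (n - j) = n choose j"
      by (rule binomial_symmetric [symmetric]) (simp add: i)
    ultimately show "(-1) ^ (n - j) * of_nat (n choose (n - j)) * F $ (n * D + r - D * (n - j)) =
        (-1) ^ n * ((-1) ^ j * of_nat (n choose j) * F $ (j * D + r))"
      by simp
  qed
  finally show ?thesis by (simp add: sum_distrib_left)
qed

text \<open>For each \<open>n\<close> the hypothesis covers only the block of \<open>D\<close>
  coefficients starting at \<open>n * D\<close>. Multiplying by \<open>1 - X^D\<close> subtracts
  coefficients at distance \<open>D\<close>, so the vanishing spreads to the block
  \<open>n + j\<close> by induction on \<open>j\<close>, for all \<open>n\<close> at once.\<close>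

lemma one_minus_X_power_mult_nth_eq_0:
  fixes E :: "complex fps"
  assumes "\<And>n r. n \<ge> m \<Longrightarrow> r < D \<Longrightarrow> ((1 - fps_X ^ D) ^ n * E) $ (n * D + r) = 0"
    and "D > 0" "t \<ge> m * D"
  shows "((1 - fps_X ^ D) ^ m * E) $ t = 0"
proof -
  have *: "((1 - fps_X ^ D) ^ n * E) $ ((n + j) * D + r) = 0" if "n \<ge> m" "r < D" for n j r
    using that(1)
  proof (induction j arbitrary: n)
    case 0
    then show ?case using assms(1)[OF _ that(2)] by simp
  next
    case (Suc j)
    let ?G = "(1 - fps_X ^ D) ^ n * E"
    \<comment> \<open>The coefficient of \<open>?G\<close> in block \<open>n + Suc j\<close> is its
      coefficient in block \<open>n + j\<close> plus that of \<open>(1 - X^D) ?G\<close> in block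
      \<open>Suc n + j\<close>. The induction hypothesis applies to both.\<close>
    have "(1 - fps_X ^ D) ^ Suc n * E = ?G - fps_X ^ D * ?G"
      by (simp add: algebra_simps)
    then have "((1 - fps_X ^ D) ^ Suc n * E) $ ((Suc n + j) * D + r) =
        ?G $ ((n + Suc j) * D + r) - ?G $ ((n + j) * D + r)"
      by (simp add: fps_X_power_mult_nth)
    then show ?case
      using Suc.IH[of n] Suc.IH[of "Suc n"] Suc.prems by simp
  qed
  have "t div D \<ge> m" using assms(2,3) by (simp add: less_eq_div_iff_mult_less_eq)
  then show ?thesis
    using *[of m "t mod D" "t div D - m"] assms(2) by simp
qed

section \<open>The polynomial \<open>P\<close> and its roots\<close>

locale congruence_system =
  fixes k :: nat and a :: "nat \<Rightarrow> int" and N :: "nat \<Rightarrow> nat"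
  assumes k_pos: "k > 0" and N_pos: "s \<in> {1..k} \<Longrightarrow> N s > 0"
begin

definition D :: nat where "D = (\<Prod>s=1..k. N s)"

definition d :: "nat \<Rightarrow> nat" where "d s = D div N s"

definition w :: "nat \<Rightarrow> complex" where "w s = cis (2 * pi * of_int (a s) / real (N s))"

definition P :: "complex poly" where "P = (\<Prod>s=1..k. 1 - monom (w s) (d s))"

definition E :: "complex fps" where
  "E = (\<Prod>s=1..k. fps_geom (w s) (d s)) - fps_const ((-1) ^ k)"

lemma D_pos: "D > 0"
  unfolding D_def using N_pos by (intro prod_pos) auto

lemma d_mult_N: "s \<in> {1..k} \<Longrightarrow> d s * N s = D"
  unfolding d_def D_def by (simp add: dvd_prodI)

lemma d_pos: "s \<in> {1..k} \<Longrightarrow> d s > 0"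
  using d_mult_N[of s] D_pos by (cases "d s") auto

lemma w_nonzero [simp]: "w s \<noteq> 0"
  by (simp add: w_def)

lemma P_nonzero: "P \<noteq> 0"
  unfolding P_def using d_pos degree_one_minus_monom(3) by auto

lemma order_P: "order x P = card {s \<in> {1..k}. w s * x ^ d s = 1}"
proof -
  have "order x P = (\<Sum>s=1..k. order x (1 - monom (w s) (d s)))"
    unfolding P_def using d_pos degree_one_minus_monom(3) by (intro order_prod_poly) auto
  also have "\<dots> = (\<Sum>s=1..k. if w s * x ^ d s = 1 then 1 else 0)"
    using d_pos by (intro sum.cong refl order_one_minus_monom) auto
  also have "\<dots> = card {s \<in> {1..k}. w s * x ^ d s = 1}"
    by (subst sum.inter_filter [symmetric]) auto
  finally show ?thesis .
qed

lemma order_one_minus_monom_D: "order (x :: complex) ((1 - monom 1 D) ^ n) = (if x ^ D = 1 then n else 0)"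
proof -
  have "order x ((1 - monom 1 D) ^ n) = order x (\<Prod>i<n. 1 - monom 1 D)"
    by simp
  also have "\<dots> = (\<Sum>i<n. order x (1 - monom 1 D))"
    using degree_one_minus_monom(3)[of 1 D] D_pos by (intro order_prod_poly) simp_all
  finally show ?thesis
    using order_one_minus_monom[of 1 D x] D_pos by simp
qed

text \<open>Since \<open>d s / D = 1 / N s\<close>, the left side is
  \<open>exp (2 pi i (a s - y) / N s)\<close>. The minus sign in the root is what yields
  \<open>y = a s\<close> instead of \<open>y = - a s\<close>.\<close>

lemma w_mult_root_eq_1_iff:
  assumes "s \<in> {1..k}"
  shows "w s * cis (- 2 * pi * of_int y / real D) ^ d s = 1 \<longleftrightarrow> [y = a s] (mod int (N s))"
proof -
  have N: "real (N s) > 0" using N_pos[OF assms] by simp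
  have d: "real (d s) > 0" using d_pos[OF assms] by simp
  have D: "real D = real (d s) * real (N s)"
    using d_mult_N[OF assms] by (metis of_nat_mult)
  have "w s * cis (- 2 * pi * of_int y / real D) ^ d s =
      cis (2 * pi * of_int (a s) / real (N s) + real (d s) * (- 2 * pi * of_int y / real D))"
    by (simp only: w_def Complex.DeMoivre cis_mult)
  also have "2 * pi * of_int (a s) / real (N s) + real (d s) * (- 2 * pi * of_int y / real D) =
      2 * pi * of_int (a s - y) / real (N s)"
    using N d by (simp add: D field_simps)
  also have "cis \<dots> = 1 \<longleftrightarrow> (\<exists>n. 2 * pi * of_int (a s - y) / real (N s) = of_int n * (2 * pi))"
    by (rule cis_eq_1_iff)
  also have "\<dots> \<longleftrightarrow> (\<exists>n. a s - y = n * int (N s))"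
  proof (intro ex_cong1)
    fix n
    have "2 * pi * of_int (a s - y) / real (N s) = of_int n * (2 * pi) \<longleftrightarrow>
        of_int (a s - y) = (of_int (n * int (N s)) :: real)"
    proof -
      have "2 * pi * of_int (a s - y) / real (N s) = of_int n * (2 * pi) \<longleftrightarrow>
          2 * pi * of_int (a s - y) = 2 * pi * (of_int n * real (N s))"
        using N by (auto simp: field_simps)
      then show ?thesis by (simp del: of_int_diff)
    qed
    then show "2 * pi * of_int (a s - y) / real (N s) = of_int n * (2 * pi) \<longleftrightarrow>
        a s - y = n * int (N s)"
      by (simp only: of_int_eq_iff)
  qed
  also have "\<dots> \<longleftrightarrow> int (N s) dvd a s - y"
    by (auto simp: dvd_def mult.commute)
  also have "\<dots> \<longleftrightarrow> [y = a s] (mod int (N s))"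
    by (simp add: cong_iff_dvd_diff dvd_diff_commute)
  finally show ?thesis .
qed

text \<open>Raising the equation to the power \<open>N s\<close> removes \<open>w s\<close>, because
  \<open>a s\<close> is an integer.\<close>

lemma root_of_unity_if_w_mult_eq_1:
  assumes "s \<in> {1..k}" "w s * x ^ d s = 1"
  shows "x ^ D = 1"
proof -
  have "w s ^ N s = cis (2 * pi * of_int (a s))"
    using N_pos[OF assms(1)] by (simp add: w_def Complex.DeMoivre)
  then have "w s ^ N s = 1"
    by (simp add: cis_multiple_2pi)
  moreover have "w s ^ N s * x ^ D = (w s * x ^ d s) ^ N s"
    by (simp add: power_mult_distrib d_mult_N[OF assms(1), symmetric] power_mult)
  ultimately show ?thesis using assms(2) by simp
qed

lemma root_of_unity_cis:
  assumes "x ^ D = 1"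
  obtains y :: int where "x = cis (- 2 * pi * of_int y / real D)"
proof -
  have "x \<in> (\<lambda>j. cis (2 * pi * real j / real D)) ` {..<D}"
    using Complex.bij_betw_roots_unity[OF D_pos] assms by (auto simp: bij_betw_def)
  then obtain j where "x = cis (2 * pi * real j / real D)" by auto
  \<comment> \<open>The standard enumeration of the roots of unity has a positive exponent, hence
    the negated witness.\<close>
  then show ?thesis by (intro that[of "- int j"]) simp
qed

lemma m_system_iff_dvd: "m_system m k a N \<longleftrightarrow> P dvd (1 - monom 1 D) ^ m"
proof -
  have "P dvd (1 - monom 1 D) ^ m \<longleftrightarrow> (\<forall>x. order x P \<le> (if x ^ D = 1 then m else 0))"
    using P_nonzero D_pos degree_one_minus_monom(3)[of 1 D]
    by (subst complex_poly_dvd_iff_order_le) (auto simp: order_one_minus_monom_D)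
  also have "\<dots> \<longleftrightarrow> (\<forall>y::int. order (cis (- 2 * pi * of_int y / real D)) P \<le> m)"
  proof safe
    fix y :: int
    assume *: "\<forall>x. order x P \<le> (if x ^ D = 1 then m else 0)"
    show "order (cis (- 2 * pi * of_int y / real D)) P \<le> m"
      by (rule order_trans[OF spec[OF *]]) simp
  next
    fix x :: complex
    assume *: "\<forall>y::int. order (cis (- 2 * pi * of_int y / real D)) P \<le> m"
    show "order x P \<le> (if x ^ D = 1 then m else 0)"
    proof (cases "x ^ D = 1")
      case True
      then obtain y :: int where "x = cis (- 2 * pi * of_int y / real D)"
        by (rule root_of_unity_cis)
      then show ?thesis using * True by simp
    next
      case False
      then have "{s \<in> {1..k}. w s * x ^ d s = 1} = {}"
        using root_of_unity_if_w_mult_eq_1 by blast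
      then have "order x P = 0" unfolding order_P by (simp only: card.empty)
      then show ?thesis by simp
    qed
  qed
  also have "\<dots> \<longleftrightarrow> (\<forall>y::int. card {s \<in> {1..k}. [y = a s] (mod int (N s))} \<le> m)"
    unfolding order_P using w_mult_root_eq_1_iff by (simp cong: conj_cong)
  finally show ?thesis unfolding m_system_def by simp
qed

section \<open>\<open>E\<close> as a proper rational function with denominator
  \<open>P\<close>\<close>

lemma E_mult_P:
  "E * fps_of_poly P = fps_of_poly (monom (\<Prod>s=1..k. w s) (\<Sum>s=1..k. d s) - smult ((-1) ^ k) P)"
proof -
  have "(\<Prod>s=1..k. fps_geom (w s) (d s)) * fps_of_poly P =
      (\<Prod>s=1..k. fps_geom (w s) (d s) * fps_of_poly (1 - monom (w s) (d s)))"
    by (simp add: P_def fps_of_poly_prod prod.distrib)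
  also have "\<dots> = (\<Prod>s=1..k. fps_of_poly (monom (w s) (d s)))"
    using d_pos by (intro prod.cong refl fps_geom_mult) auto
  also have "\<dots> = fps_of_poly (monom (\<Prod>s=1..k. w s) (\<Sum>s=1..k. d s))"
    by (simp add: fps_of_poly_prod [symmetric] prod_monom)
  finally show ?thesis
    by (simp add: E_def left_diff_distrib fps_of_poly_diff fps_of_poly_smult)
qed

lemma degree_P: "degree P = (\<Sum>s=1..k. d s)"
  unfolding P_def using d_pos degree_one_minus_monom
  by (subst degree_prod_sum_eq) auto

lemma lead_coeff_P: "coeff P (\<Sum>s=1..k. d s) = (-1) ^ k * (\<Prod>s=1..k. w s)"
proof -
  have "lead_coeff P = (\<Prod>s=1..k. lead_coeff (1 - monom (w s) (d s)))"
    unfolding P_def by (rule lead_coeff_prod)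
  also have "\<dots> = (\<Prod>s=1..k. (-1) * w s)"
    using d_pos degree_one_minus_monom(2) by (intro prod.cong refl) auto
  also have "\<dots> = (-1) ^ k * (\<Prod>s=1..k. w s)"
    by (simp only: prod.distrib) simp
  finally show ?thesis by (simp add: degree_P)
qed

text \<open>Both terms have the coefficient \<open>\<Prod>s=1..k. w s\<close> in degree
  \<open>degree P\<close>, as the two signs \<open>(-1) ^ k\<close> cancel. If the difference is the
  zero polynomial, strictness comes from \<open>degree P > 0\<close>, which rests on
  \<open>k > 0\<close>.\<close>

lemma degree_numerator_less:
  "degree (monom (\<Prod>s=1..k. w s) (\<Sum>s=1..k. d s) - smult ((-1) ^ k) P) < degree P"
  (is "degree ?R < _")
proof (rule le_neq_implies_less)
  have pos: "degree P > 0"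
    unfolding degree_P using d_pos[of 1] k_pos by (intro sum_pos2[of _ 1]) auto
  show "degree ?R \<le> degree P"
    by (intro degree_diff_le) (auto simp: degree_P intro: degree_monom_le)
  show "degree ?R \<noteq> degree P"
  proof
    assume eq: "degree ?R = degree P"
    have "lead_coeff ?R = 0"
      unfolding eq by (simp add: degree_P lead_coeff_P mult.assoc [symmetric] del: One_nat_def flip: power_mult_distrib)
    then have "?R = 0" by (simp only: leading_coeff_0_iff)
    then show False using eq pos by (simp only: degree_0)
  qed
qed

lemma fps_of_poly_one_minus_monom:
  "fps_of_poly ((1 - monom 1 D) ^ n) = (1 - fps_X ^ D :: complex fps) ^ n"
  by (simp add: fps_of_poly_power fps_of_poly_diff fps_of_poly_monom)

text \<open>If \<open>(1 - X^D)^n = P Q\<close>, then multiplying by \<open>E = R / P\<close> leaves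
  the polynomial \<open>R Q\<close>, whose degree is below
  \<open>degree P + degree Q = n * D\<close>.\<close>

lemma dvd_imp_nth_eq_0:
  assumes "P dvd (1 - monom 1 D) ^ n" "t \<ge> n * D"
  shows "((1 - fps_X ^ D) ^ n * E) $ t = 0"
proof -
  let ?R = "monom (\<Prod>s=1..k. w s) (\<Sum>s=1..k. d s) - smult ((-1) ^ k) P"
  let ?u = "(1 - monom 1 D) ^ n :: complex poly"
  obtain Q where Q: "?u = P * Q" using assms(1) by (auto elim: dvdE)
  have u: "?u \<noteq> 0" using degree_one_minus_monom(3)[of 1 D] D_pos by simp
  then have "Q \<noteq> 0" using Q by auto
  then have "degree P + degree Q = degree ?u"
    using Q P_nonzero by (simp add: degree_mult_eq)
  also have "\<dots> = n * D"
    using degree_one_minus_monom[of 1 D] D_pos by (simp add: degree_power_eq)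
  finally have "degree (?R * Q) < n * D"
    using degree_mult_le[of ?R Q] degree_numerator_less by linarith
  then have "coeff (?R * Q) t = 0"
    using assms(2) by (intro coeff_eq_0) simp
  moreover have "(1 - fps_X ^ D) ^ n * E = fps_of_poly (?R * Q)"
    using E_mult_P unfolding fps_of_poly_one_minus_monom [symmetric] Q
    by (simp add: fps_of_poly_mult mult_ac)
  ultimately show ?thesis by simp
qed

lemma nth_eq_0_imp_dvd:
  assumes "\<And>t. t \<ge> m * D \<Longrightarrow> ((1 - fps_X ^ D) ^ m * E) $ t = 0"
  shows "P dvd (1 - monom 1 D) ^ m"
proof -
  let ?e = "\<Sum>s=1..k. d s" and ?W = "\<Prod>s=1..k. w s"
  let ?u = "(1 - monom 1 D) ^ m :: complex poly"
  define T where "T = Abs_poly (fps_nth ((1 - fps_X ^ D) ^ m * E))"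
  have "fps_of_poly T = (1 - fps_X ^ D) ^ m * E"
  proof (rule fps_ext)
    fix n
    show "fps_of_poly T $ n = ((1 - fps_X ^ D) ^ m * E) $ n"
      unfolding T_def fps_of_poly_nth
      by (subst coeff_Abs_poly[of "m * D"]) (use assms in auto)
  qed
  then have "fps_of_poly (T * P) = fps_of_poly (?u * (monom ?W ?e - smult ((-1) ^ k) P))"
    by (simp only: fps_of_poly_mult E_mult_P [symmetric] fps_of_poly_one_minus_monom mult.assoc)
  then have "T * P = ?u * (monom ?W ?e - smult ((-1) ^ k) P)"
    by (simp only: fps_of_poly_eq_iff)
  \<comment> \<open>The multiple of \<open>P\<close> in the numerator is moved to the other
    side.\<close>
  then have "?u * monom ?W ?e = P * (T + smult ((-1) ^ k) ?u)"
    by (simp add: algebra_simps)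
  then have dvd: "P dvd ?u * monom ?W ?e" by simp
  have W: "?W \<noteq> 0" by simp
  have u: "?u \<noteq> 0" using degree_one_minus_monom(3)[of 1 D] D_pos by simp
  have "order x P \<le> order x ?u" for x
  proof (cases "x = 0")
    case True
    have "{s \<in> {1..k}. w s * x ^ d s = 1} = {}"
      using d_pos True by (force simp: power_0_left)
    then have "order x P = 0" unfolding order_P by (simp only: card.empty)
    then show ?thesis by simp
  next
    case False
    have "order x P \<le> order x (?u * monom ?W ?e)"
      using dvd u W by (intro dvd_imp_order_le) auto
    also have "\<dots> = order x ?u + order x (monom ?W ?e)"
      using u W by (intro order_mult) auto
    also have "order x (monom ?W ?e) = 0"
      using False W by (intro order_0I) (simp add: poly_monom)
    finally show ?thesis by simp
  qed
  then show ?thesis using P_nonzero u by (subst complex_poly_dvd_iff_order_le) auto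
qed

section \<open>The sums \<open>S_sum\<close> as power series coefficients\<close>

text \<open>With the common denominator \<open>D\<close>, floor and fractional part become
  \<open>div\<close> and \<open>mod\<close> of an integer sum.\<close>

lemma frac_sum_eq: "frac_sum k N f = real (\<Sum>s=1..k. d s * f s) / real D"
proof -
  have "real (f s) / real (N s) = real (d s * f s) / real D" if "s \<in> {1..k}" for s
  proof -
    have "real D = real (d s) * real (N s)"
      using d_mult_N[OF that] by (metis of_nat_mult)
    then show ?thesis using N_pos[OF that] d_pos[OF that] by (simp add: field_simps)
  qed
  then show ?thesis by (simp add: frac_sum_def sum_divide_distrib)
qed

lemma floor_frac_sum: "\<lfloor>frac_sum k N f\<rfloor> = int ((\<Sum>s=1..k. d s * f s) div D)"
  unfolding frac_sum_eq by (rule floor_divide_of_nat_eq)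

lemma frac_frac_sum: "frac (frac_sum k N f) = real ((\<Sum>s=1..k. d s * f s) mod D) / real D"
proof -
  let ?M = "\<Sum>s=1..k. d s * f s"
  have "real ?M = real (?M div D) * real D + real (?M mod D)"
    by (metis div_mult_mod_eq of_nat_add of_nat_mult)
  then have "real ?M / real D = real (?M div D) + real (?M mod D) / real D"
    using D_pos by (simp add: field_simps)
  then show ?thesis
    unfolding frac_def floor_frac_sum by (simp add: frac_sum_eq)
qed

lemma exp_sum_eq:
  "exp (2 * of_real pi * \<i> * (\<Sum>s=1..k. of_int (a s) * of_nat (f s) / of_nat (N s))) =
    (\<Prod>s=1..k. w s ^ f s)"
proof -
  have "exp (2 * of_real pi * \<i> * (\<Sum>s=1..k. of_int (a s) * of_nat (f s) / of_nat (N s))) =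
      (\<Prod>s=1..k. exp (2 * of_real pi * \<i> * (of_int (a s) * of_nat (f s) / of_nat (N s))))"
    by (simp add: sum_distrib_left exp_sum)
  also have "\<dots> = (\<Prod>s=1..k. w s ^ f s)"
    by (intro prod.cong refl)
      (simp add: w_def cis_conv_exp exp_of_nat_mult [symmetric] mult_ac)
  finally show ?thesis .
qed

text \<open>Tuples are grouped by the floor \<open>j\<close>. Those with fractional part
  \<open>r / D\<close> are then exactly the ones with
  \<open>(\<Sum>s=1..k. d s * f s) = j * D + r\<close>, and their weights add up to one coefficient
  of the product.\<close>

lemma S_sum_eq_sum_nth:
  assumes "r < D"
  shows "S_sum k a N n (real r / real D) =
    (\<Sum>j\<le>n. (-1) ^ j * of_nat (n choose j) * (\<Prod>s=1..k. fps_geom (w s) (d s)) $ (j * D + r))"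
proof -
  define M where "M = (\<lambda>f. \<Sum>s=1..k. d s * f s)"
  define A where "A = {f \<in> {1..k} \<rightarrow>\<^sub>E {1..}. frac (frac_sum k N f) = real r / real D \<and>
    \<lfloor>frac_sum k N f\<rfloor> \<le> int n}"
  have A_eq: "A = {f \<in> {1..k} \<rightarrow>\<^sub>E {1..}. M f mod D = r \<and> M f div D \<le> n}"
    unfolding A_def floor_frac_sum frac_frac_sum M_def using D_pos by auto
  have fin: "finite A"
    unfolding A_def by (rule finite_bounded_tuples) (rule N_pos)
  have "S_sum k a N n (real r / real D) =
      (\<Sum>f\<in>A. (-1) ^ (M f div D) * of_nat (n choose (M f div D)) * (\<Prod>s=1..k. w s ^ f s))"
    unfolding A_def by (subst S_sum_eq_finite_sum)
      (auto simp: N_pos exp_sum_eq floor_frac_sum M_def simp del: One_nat_def)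
  also have "\<dots> = (\<Sum>j\<le>n. \<Sum>f | f \<in> A \<and> M f div D = j.
      (-1) ^ (M f div D) * of_nat (n choose (M f div D)) * (\<Prod>s=1..k. w s ^ f s))"
    using fin by (intro sum.group [symmetric]) (auto simp: A_eq)
  also have "\<dots> = (\<Sum>j\<le>n. (-1) ^ j * of_nat (n choose j) *
      (\<Prod>s=1..k. fps_geom (w s) (d s)) $ (j * D + r))"
  proof (intro sum.cong refl)
    fix j assume j: "j \<in> {..n}"
    have set_eq: "{f. f \<in> A \<and> M f div D = j} =
        {f. f \<in> {1..k} \<rightarrow>\<^sub>E {1..} \<and> (\<Sum>s=1..k. d s * f s) = j * D + r}"
    proof -
      have "M f mod D = r \<and> M f div D \<le> n \<and> M f div D = j \<longleftrightarrow> M f = j * D + r" for f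
      proof
        assume "M f mod D = r \<and> M f div D \<le> n \<and> M f div D = j"
        then show "M f = j * D + r" using div_mult_mod_eq[of "M f" D] by simp
      qed (use j assms D_pos in simp)
      then show ?thesis unfolding A_eq M_def by blast
    qed
    have "(\<Sum>f | f \<in> A \<and> M f div D = j.
        (-1) ^ (M f div D) * of_nat (n choose (M f div D)) * (\<Prod>s=1..k. w s ^ f s)) =
      (\<Sum>f | f \<in> A \<and> M f div D = j. (-1) ^ j * of_nat (n choose j) * (\<Prod>s=1..k. w s ^ f s))"
      by (intro sum.cong) auto
    also have "\<dots> = (-1) ^ j * of_nat (n choose j) *
        (\<Prod>s=1..k. fps_geom (w s) (d s)) $ (j * D + r)"
      unfolding set_eq using d_pos by (subst fps_prod_geom_nth) (auto simp: sum_distrib_left)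
    finally show "(\<Sum>f | f \<in> A \<and> M f div D = j.
        (-1) ^ (M f div D) * of_nat (n choose (M f div D)) * (\<Prod>s=1..k. w s ^ f s)) =
      (-1) ^ j * of_nat (n choose j) * (\<Prod>s=1..k. fps_geom (w s) (d s)) $ (j * D + r)" .
  qed
  finally show ?thesis .
qed

text \<open>The constant subtracted in \<open>E\<close> accounts for the claimed value: as
  \<open>D > 0\<close>, the index \<open>j * D + r\<close> is 0 only for
  \<open>j = r = 0\<close>.\<close>

lemma S_sum_eq_iff_nth_eq_0:
  assumes "r < D"
  shows "S_sum k a N n (real r / real D) = (if r = 0 then (-1) ^ k else 0) \<longleftrightarrow>
    ((1 - fps_X ^ D) ^ n * E) $ (n * D + r) = 0"
proof -
  let ?F = "\<Prod>s=1..k. fps_geom (w s) (d s)"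
  have const: "(\<Sum>j\<le>n. (-1) ^ j * of_nat (n choose j) * fps_const ((-1) ^ k) $ (j * D + r)) =
      (if r = 0 then (-1) ^ k else 0 :: complex)"
  proof -
    have "(\<Sum>j\<le>n. (-1) ^ j * of_nat (n choose j) * fps_const ((-1) ^ k) $ (j * D + r)) =
        (\<Sum>j\<le>n. if j = 0 then if r = 0 then (-1) ^ k else 0 else 0 :: complex)"
      using D_pos by (intro sum.cong refl) auto
    then show ?thesis by simp
  qed
  have "((1 - fps_X ^ D) ^ n * E) $ (n * D + r) = (-1) ^ n *
      (S_sum k a N n (real r / real D) - (if r = 0 then (-1) ^ k else 0))"
    unfolding one_minus_X_power_mult_nth S_sum_eq_sum_nth[OF assms] const [symmetric] E_def
    by (simp add: sum_subtractf [symmetric] right_diff_distrib del: fps_nth_fps_const fps_const_power)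
  then show ?thesis by simp
qed

text \<open>Every fractional part that occurs is a multiple of \<open>1 / D\<close>, so the index
  set is empty.\<close>

lemma S_sum_eq_0:
  assumes "\<And>r. r < D \<Longrightarrow> \<alpha> \<noteq> real r / real D"
  shows "S_sum k a N n \<alpha> = 0"
proof -
  have "frac (frac_sum k N f) \<noteq> \<alpha>" for f
    using assms D_pos unfolding frac_frac_sum by (metis mod_less_divisor)
  then show ?thesis unfolding S_sum_def by simp
qed

section \<open>The equivalence\<close>

lemma m_system_iff:
  "m_system m k a N \<longleftrightarrow> (\<forall>n \<alpha>. m \<le> n \<and> n < k \<and> 0 \<le> \<alpha> \<and> \<alpha> < 1 \<longrightarrow>
     S_sum k a N n \<alpha> = (if \<alpha> = 0 then (-1) ^ k else 0))"
proof
  assume sys: "m_system m k a N"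
  show "\<forall>n \<alpha>. m \<le> n \<and> n < k \<and> 0 \<le> \<alpha> \<and> \<alpha> < 1 \<longrightarrow>
     S_sum k a N n \<alpha> = (if \<alpha> = 0 then (-1) ^ k else 0)"
  proof (intro allI impI)
    fix n and \<alpha> :: real
    assume n: "m \<le> n \<and> n < k \<and> 0 \<le> \<alpha> \<and> \<alpha> < 1"
    show "S_sum k a N n \<alpha> = (if \<alpha> = 0 then (-1) ^ k else 0)"
    proof (cases "\<exists>r<D. \<alpha> = real r / real D")
      case True
      then obtain r where r: "r < D" "\<alpha> = real r / real D" by blast
      \<comment> \<open>Divisibility passes from the exponent \<open>m\<close> to the larger
        exponent \<open>n\<close>.\<close>
      have "P dvd (1 - monom 1 D) ^ n"
        using sys n by (meson m_system_iff_dvd dvd_trans le_imp_power_dvd)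
      then have "((1 - fps_X ^ D) ^ n * E) $ (n * D + r) = 0"
        by (rule dvd_imp_nth_eq_0) simp
      then show ?thesis
        using S_sum_eq_iff_nth_eq_0[OF r(1), of n] r D_pos by simp
    next
      case False
      moreover from False have "\<alpha> \<noteq> 0" using D_pos by auto
      ultimately show ?thesis using S_sum_eq_0 by auto
    qed
  qed
next
  assume S: "\<forall>n \<alpha>. m \<le> n \<and> n < k \<and> 0 \<le> \<alpha> \<and> \<alpha> < 1 \<longrightarrow>
     S_sum k a N n \<alpha> = (if \<alpha> = 0 then (-1) ^ k else 0)"
  have "((1 - fps_X ^ D) ^ n * E) $ (n * D + r) = 0" if "n \<ge> m" "r < D" for n r
  proof (cases "n < k")
    case True
    then have "S_sum k a N n (real r / real D) = (if r = 0 then (-1) ^ k else 0)"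
      using S that D_pos by simp
    then show ?thesis using S_sum_eq_iff_nth_eq_0[OF that(2)] by simp
  next
    case False
    \<comment> \<open>There are only \<open>k\<close> indices, so for \<open>n \<ge> k\<close> the
      bound \<open>n\<close> can never be exceeded and the coefficients vanish by the direction
      already proved.\<close>
    have "card {s \<in> {1..k}. [x = a s] (mod int (N s))} \<le> n" for x
      using card_mono[of "{1..k}" "{s \<in> {1..k}. [x = a s] (mod int (N s))}"] False by fastforce
    then have "P dvd (1 - monom 1 D) ^ n"
      by (simp add: m_system_iff_dvd [symmetric] m_system_def)
    then show ?thesis by (rule dvd_imp_nth_eq_0) simp
  qed
  then have "((1 - fps_X ^ D) ^ m * E) $ t = 0" if "t \<ge> m * D" for t
    using D_pos that by (rule one_minus_X_power_mult_nth_eq_0)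
  then show "m_system m k a N"
    unfolding m_system_iff_dvd by (rule nth_eq_0_imp_dvd)
qed

end

theorem theorem1p3:
  fixes m k :: nat and a :: "nat \<Rightarrow> int" and N :: "nat \<Rightarrow> nat"
  assumes "m > 0" and "k > 0"
    and "\<And>s. s \<in> {1..k} \<Longrightarrow> N s > 0"
  shows "m_system m k a N \<longleftrightarrow>
    (\<forall>n::nat. \<forall>\<alpha>::real. m \<le> n \<and> n < k \<and> 0 \<le> \<alpha> \<and> \<alpha> < 1 \<longrightarrow>
       S_sum k a N n \<alpha> = (if \<alpha> = 0 then (-1) ^ k else 0))"
proof -
  interpret congruence_system k a N
    by unfold_locales (use assms in auto)
  show ?thesis by (rule m_system_iff)
qed

end
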